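(* Let $p\ge3$ be a prime, $q\ge1$ an integer, $\theta=p^N$ with $N<0$ (so $|\theta|_p>1$), and let $f(x)=\left(\frac{\theta x+q}{x+\theta+q-1}\right)^2$ have the three fixed points $x_0=1$, $x_1$, $x_2$ in $\mathbb{Q}_p$. Then the fixed point $x_0$ is neutral, and the fixed points $x_1,x_2$ are attractive.
   Context: $|\cdot|_p$ is the $p$-adic absolute value. $x_1,x_2$ are the roots of $x^2+(2\theta-\theta^2+2q-1)x+q^2=0$ (labelled so that $|x_1|_p=|\theta|_p^2$ and $|x_2|_p=|q/\theta|_p^2$), assumed to lie in $\mathbb{Q}_p$. A fixed point $x$ with $\lambda=f'(x)$ is attractive if $|\lambda|_p<1$, neutral (indifferent) if $|\lambda|_p=1$, repelling if $|\lambda|_p>1$. *)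

theory Defs
  imports Complex_Main "Berlekamp_Zassenhaus.Finite_Field"
begin

section \<open>The \<open>p\<close>-adic absolute value on the rationals\<close>

definition rat_padic_val :: "nat \<Rightarrow> rat \<Rightarrow> int" where
  "rat_padic_val p r =
     int (multiplicity (int p) (fst (quotient_of r))) - int (multiplicity (int p) (snd (quotient_of r)))"

definition rat_padic_abs :: "nat \<Rightarrow> rat \<Rightarrow> real" where
  "rat_padic_abs p r = (if r = 0 then 0 else real p powi (- rat_padic_val p r))"

lemma rat_padic_abs_0 [simp]: "rat_padic_abs p 0 = 0"
  by (simp add: rat_padic_abs_def)

lemma rat_padic_abs_nonneg [simp]: "rat_padic_abs p r \<ge> 0"
  by (simp add: rat_padic_abs_def)

lemma rat_padic_abs_eq_0_iff:
  assumes "prime p" shows "rat_padic_abs p r = 0 \<longleftrightarrow> r = 0"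
  using prime_gt_0_nat[OF assms] by (simp add: rat_padic_abs_def)

lemma rat_padic_val_Fract:
  assumes "prime p" "a \<noteq> 0" "b \<noteq> 0"
  shows "rat_padic_val p (Rat.Fract a b) = int (multiplicity (int p) a) - int (multiplicity (int p) b)"
proof -
  obtain n d where nd: "quotient_of (Rat.Fract a b) = (n, d)" by force
  have d: "d > 0" using quotient_of_denom_pos[OF nd] .
  have "Rat.Fract a b = of_int n / of_int d" using quotient_of_div[OF nd] .
  then have eq: "a * d = n * b"
    using assms d by (simp add: Fract_of_int_quotient[symmetric] eq_rat)
  then have n: "n \<noteq> 0" using assms d by auto
  have p: "prime_elem (int p)" using assms by (simp add: prime_imp_prime_elem)
  have "multiplicity (int p) a + multiplicity (int p) d = multiplicity (int p) n + multiplicity (int p) b"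
    using arg_cong[OF eq, of "multiplicity (int p)"] p assms d n
    by (simp add: prime_elem_multiplicity_mult_distrib)
  then show ?thesis by (simp add: rat_padic_val_def nd)
qed

lemma rat_padic_abs_1 [simp]: "rat_padic_abs p 1 = 1"
  by (simp add: rat_padic_abs_def rat_padic_val_def)

lemma rat_padic_abs_mult:
  assumes "prime p"
  shows "rat_padic_abs p (r * s) = rat_padic_abs p r * rat_padic_abs p s"
proof (cases "r = 0 \<or> s = 0")
  case True then show ?thesis by auto
next
  case False
  obtain a b where r: "r = Rat.Fract a b" "b > 0" by (cases r)
  obtain c d where s: "s = Rat.Fract c d" "d > 0" by (cases s)
  have nz: "a \<noteq> 0" "c \<noteq> 0" using False r s by (auto simp: rat_number_collapse)
  have p: "prime_elem (int p)" using assms by (simp add: prime_imp_prime_elem)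
  have "rat_padic_val p (r * s) = rat_padic_val p r + rat_padic_val p s"
    using r s nz assms p by (simp add: rat_padic_val_Fract prime_elem_multiplicity_mult_distrib)
  then show ?thesis
    using False prime_gt_0_nat[OF assms]
    by (simp add: rat_padic_abs_def power_int_diff power_int_minus power_int_add field_simps)
qed

lemma rat_padic_abs_minus [simp]:
  assumes "prime p" shows "rat_padic_abs p (- r) = rat_padic_abs p r"
proof (cases "r = 0")
  case False
  obtain a b where r: "r = Rat.Fract a b" "b > 0" by (cases r)
  then have "a \<noteq> 0" using False by (auto simp: rat_number_collapse)
  moreover have "- r = Rat.Fract (- a) b" using r by simp
  moreover have "multiplicity (int p) (- a) = multiplicity (int p) a"
    by (simp add: multiplicity_def)
  ultimately have "rat_padic_val p (- r) = rat_padic_val p r"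
    using r assms by (simp add: rat_padic_val_Fract)
  then show ?thesis using False by (simp add: rat_padic_abs_def)
qed simp

lemma rat_padic_abs_inverse:
  assumes "prime p" shows "rat_padic_abs p (inverse r) = inverse (rat_padic_abs p r)"
proof (cases "r = 0")
  case False
  have "rat_padic_abs p r * rat_padic_abs p (inverse r) = 1"
    using False by (simp add: rat_padic_abs_mult[OF assms, symmetric])
  then show ?thesis by (metis inverse_unique)
qed simp

lemma rat_padic_abs_add:
  assumes "prime p"
  shows "rat_padic_abs p (r + s) \<le> max (rat_padic_abs p r) (rat_padic_abs p s)"
proof (cases "r = 0 \<or> s = 0 \<or> r + s = 0")
  case True then show ?thesis by (auto simp: le_max_iff_disj)
next
  case False
  obtain a b where r: "r = Rat.Fract a b" "b > 0" by (cases r)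
  obtain c d where s: "s = Rat.Fract c d" "d > 0" by (cases s)
  have p: "prime_elem (int p)" using assms by (simp add: prime_imp_prime_elem)
  have r': "r = Rat.Fract (a * d) (b * d)" and s': "s = Rat.Fract (c * b) (b * d)"
    using r s by (auto simp: eq_rat)
  have rs: "r + s = Rat.Fract (a * d + c * b) (b * d)" using r s by (simp add: algebra_simps)
  have nz: "a * d \<noteq> 0" "c * b \<noteq> 0" "b * d \<noteq> 0" "a * d + c * b \<noteq> 0"
    using False r s rs by (auto simp: rat_number_collapse)
  let ?m = "multiplicity (int p)"
  have "int p ^ min (?m (a * d)) (?m (c * b)) dvd a * d + c * b"
    by (intro dvd_add) (auto intro!: multiplicity_dvd')
  then have "min (?m (a * d)) (?m (c * b)) \<le> ?m (a * d + c * b)"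
    using nz p by (intro multiplicity_geI) auto
  then have "min (rat_padic_val p r) (rat_padic_val p s) \<le> rat_padic_val p (r + s)"
    unfolding rs unfolding r' s' using nz assms by (simp add: rat_padic_val_Fract del: mult_eq_0_iff)
  then have "rat_padic_val p r \<le> rat_padic_val p (r + s) \<or> rat_padic_val p s \<le> rat_padic_val p (r + s)"
    by auto
  moreover have "1 \<le> real p" using prime_gt_0_nat[OF assms] by simp
  ultimately show ?thesis using False
    by (auto simp: rat_padic_abs_def le_max_iff_disj intro: power_int_increasing)
qed

lemma rat_padic_abs_add_less:
  assumes "prime p" "rat_padic_abs p r < e" "rat_padic_abs p s < e"
  shows "rat_padic_abs p (r + s) < e"
  using rat_padic_abs_add[OF assms(1), of r s] assms by simp

lemma rat_padic_abs_triangle: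
  assumes "prime p"
  shows "rat_padic_abs p (r + s) \<le> rat_padic_abs p r + rat_padic_abs p s"
  using rat_padic_abs_add[OF assms, of r s] rat_padic_abs_nonneg[of p r] rat_padic_abs_nonneg[of p s]
  by linarith

lemma rat_padic_abs_diff_abs:
  assumes "prime p"
  shows "\<bar>rat_padic_abs p r - rat_padic_abs p s\<bar> \<le> rat_padic_abs p (r - s)"
  using rat_padic_abs_triangle[OF assms, of "r - s" s] rat_padic_abs_triangle[OF assms, of "s - r" r]
    rat_padic_abs_minus[OF assms, of "r - s"] by simp


section \<open>The field of \<open>p\<close>-adic numbers as the completion of the rationals\<close>

definition padic_cauchy :: "nat \<Rightarrow> (nat \<Rightarrow> rat) \<Rightarrow> bool" where
  "padic_cauchy p X \<longleftrightarrow> (\<forall>e>0. \<exists>M. \<forall>m\<ge>M. \<forall>n\<ge>M. rat_padic_abs p (X m - X n) < e)"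

definition padic_null :: "nat \<Rightarrow> (nat \<Rightarrow> rat) \<Rightarrow> bool" where
  "padic_null p X \<longleftrightarrow> (\<lambda>n. rat_padic_abs p (X n)) \<longlonglongrightarrow> 0"

lemma padic_null_iff: "padic_null p X \<longleftrightarrow> (\<forall>e>0. \<exists>M. \<forall>n\<ge>M. rat_padic_abs p (X n) < e)"
  unfolding padic_null_def LIMSEQ_def by simp

lemma padic_null_add:
  assumes "prime p" "padic_null p X" "padic_null p Y"
  shows "padic_null p (\<lambda>n. X n + Y n)"
  unfolding padic_null_iff
proof (intro allI impI)
  fix e :: real assume "e > 0"
  then obtain M N where "\<forall>n\<ge>M. rat_padic_abs p (X n) < e" "\<forall>n\<ge>N. rat_padic_abs p (Y n) < e"
    using assms unfolding padic_null_iff by metis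
  then show "\<exists>M. \<forall>n\<ge>M. rat_padic_abs p (X n + Y n) < e"
    by (intro exI[of _ "max M N"]) (auto intro: rat_padic_abs_add_less assms)
qed

lemma padic_null_minus:
  assumes "prime p" "padic_null p X" shows "padic_null p (\<lambda>n. - X n)"
  using assms by (simp add: padic_null_def)

lemma padic_cauchy_const [simp]: "padic_cauchy p (\<lambda>_. r)"
  by (simp add: padic_cauchy_def)

lemma padic_cauchy_minus:
  assumes "prime p" "padic_cauchy p X" shows "padic_cauchy p (\<lambda>n. - X n)"
proof -
  have "rat_padic_abs p (- X m - - X n) = rat_padic_abs p (X m - X n)" for m n
    using rat_padic_abs_minus[OF assms(1), of "X m - X n"] by (simp add: algebra_simps)
  then show ?thesis using assms unfolding padic_cauchy_def by presburger
qed

lemma padic_cauchy_add: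
  assumes "prime p" "padic_cauchy p X" "padic_cauchy p Y"
  shows "padic_cauchy p (\<lambda>n. X n + Y n)"
  unfolding padic_cauchy_def
proof (intro allI impI)
  fix e :: real assume "e > 0"
  then obtain M N where MN: "\<forall>m\<ge>M. \<forall>n\<ge>M. rat_padic_abs p (X m - X n) < e"
      "\<forall>m\<ge>N. \<forall>n\<ge>N. rat_padic_abs p (Y m - Y n) < e"
    using assms unfolding padic_cauchy_def by metis
  have "rat_padic_abs p (X m + Y m - (X n + Y n)) < e" if "m \<ge> max M N" "n \<ge> max M N" for m n
    using rat_padic_abs_add_less[OF assms(1), of "X m - X n" e "Y m - Y n"] MN that
    by (simp add: algebra_simps)
  then show "\<exists>M. \<forall>m\<ge>M. \<forall>n\<ge>M. rat_padic_abs p (X m + Y m - (X n + Y n)) < e" by blast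
qed

lemma padic_cauchy_bounded:
  assumes "prime p" "padic_cauchy p X"
  obtains B where "B > 0" "\<And>n. rat_padic_abs p (X n) < B"
proof -
  obtain M where M: "\<forall>m\<ge>M. \<forall>n\<ge>M. rat_padic_abs p (X m - X n) < 1"
    using assms unfolding padic_cauchy_def by (metis zero_less_one)
  define B where "B = 1 + rat_padic_abs p (X M) + (\<Sum>n<M. rat_padic_abs p (X n))"
  have s: "(\<Sum>n<M. rat_padic_abs p (X n)) \<ge> 0" by (simp add: sum_nonneg)
  have "rat_padic_abs p (X n) < B" for n
  proof (cases "n < M")
    case True
    then have "rat_padic_abs p (X n) \<le> (\<Sum>n<M. rat_padic_abs p (X n))"
      by (intro member_le_sum) auto
    then show ?thesis using rat_padic_abs_nonneg[of p "X M"] unfolding B_def by linarith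
  next
    case False
    then have "rat_padic_abs p (X n - X M) < 1" using M by simp
    then show ?thesis using rat_padic_abs_triangle[OF assms(1), of "X n - X M" "X M"] s
      unfolding B_def by simp
  qed
  moreover have "B > 0" using s rat_padic_abs_nonneg[of p "X M"] unfolding B_def by linarith
  ultimately show ?thesis using that by blast
qed

lemma padic_null_mult:
  assumes "prime p" "padic_null p X" "padic_cauchy p Y"
  shows "padic_null p (\<lambda>n. X n * Y n)"
proof -
  obtain B where B: "B > 0" "\<And>n. rat_padic_abs p (Y n) < B"
    using padic_cauchy_bounded assms by metis
  have "(\<lambda>n. rat_padic_abs p (X n) * B) \<longlonglongrightarrow> 0"
    using assms unfolding padic_null_def by (simp add: tendsto_mult_left_zero)
  then show ?thesis unfolding padic_null_def
    by (rule tendsto_sandwich[OF _ _ tendsto_const, rotated 2])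
       (auto intro!: always_eventually mult_left_mono less_imp_le[OF B(2)] simp: rat_padic_abs_mult assms)
qed

lemma padic_cauchy_mult:
  assumes "prime p" "padic_cauchy p X" "padic_cauchy p Y"
  shows "padic_cauchy p (\<lambda>n. X n * Y n)"
  unfolding padic_cauchy_def
proof (intro allI impI)
  fix e :: real assume e: "e > 0"
  obtain A where A: "A > 0" "\<And>n. rat_padic_abs p (X n) < A"
    using padic_cauchy_bounded assms by metis
  obtain B where B: "B > 0" "\<And>n. rat_padic_abs p (Y n) < B"
    using padic_cauchy_bounded assms by metis
  have "e / B > 0" "e / A > 0" using e A B by auto
  then obtain M N where MN: "\<forall>m\<ge>M. \<forall>n\<ge>M. rat_padic_abs p (X m - X n) < e / B"
      "\<forall>m\<ge>N. \<forall>n\<ge>N. rat_padic_abs p (Y m - Y n) < e / A"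
    using assms unfolding padic_cauchy_def by metis
  have "rat_padic_abs p (X m * Y m - X n * Y n) < e" if mn: "m \<ge> max M N" "n \<ge> max M N" for m n
  proof -
    have "rat_padic_abs p ((X m - X n) * Y m) < e / B * B"
      unfolding rat_padic_abs_mult[OF assms(1)]
      using MN mn B \<open>e / B > 0\<close> by (intro mult_strict_mono) auto
    moreover have "rat_padic_abs p (X n * (Y m - Y n)) < A * (e / A)"
      unfolding rat_padic_abs_mult[OF assms(1)]
      using MN mn A \<open>e / A > 0\<close> by (intro mult_strict_mono) auto
    ultimately have "rat_padic_abs p ((X m - X n) * Y m + X n * (Y m - Y n)) < e"
      using A B by (intro rat_padic_abs_add_less assms) auto
    then show ?thesis by (simp add: algebra_simps)
  qed
  then show "\<exists>M. \<forall>m\<ge>M. \<forall>n\<ge>M. rat_padic_abs p (X m * Y m - X n * Y n) < e" by blast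
qed

lemma padic_cauchy_nonnull:
  assumes "prime p" "padic_cauchy p X" "\<not> padic_null p X"
  obtains c M where "c > 0" "\<And>n. n \<ge> M \<Longrightarrow> rat_padic_abs p (X n) = c"
proof -
  obtain e where e: "e > 0" "\<And>M. \<exists>n\<ge>M. rat_padic_abs p (X n) \<ge> e"
    using assms(3) unfolding padic_null_iff by (metis not_less)
  obtain M where M: "\<forall>m\<ge>M. \<forall>n\<ge>M. rat_padic_abs p (X m - X n) < e"
    using assms(2) e unfolding padic_cauchy_def by metis
  obtain k where k: "k \<ge> M" "rat_padic_abs p (X k) \<ge> e" using e by blast
  have "rat_padic_abs p (X n) = rat_padic_abs p (X k)" if "n \<ge> M" for n
  proof -
    have "rat_padic_abs p (X n - X k) < e" "rat_padic_abs p (X k - X n) < e" using M that k by auto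
    then show ?thesis
      using rat_padic_abs_add[OF assms(1), of "X n - X k" "X k"]
        rat_padic_abs_add[OF assms(1), of "X k - X n" "X n"] k by auto
  qed
  moreover have "rat_padic_abs p (X k) > 0" using k e by linarith
  ultimately show ?thesis using that by blast
qed

lemma padic_null_cong:
  assumes "prime p" "padic_null p (\<lambda>n. X n - Y n)" shows "padic_null p X \<longleftrightarrow> padic_null p Y"
proof
  assume "padic_null p Y"
  then show "padic_null p X"
    using padic_null_add[OF assms(1), of "\<lambda>n. X n - Y n" Y] assms by simp
next
  assume "padic_null p X"
  then show "padic_null p Y"
    using padic_null_add[OF assms(1) padic_null_minus[OF assms(1), of "\<lambda>n. X n - Y n"], of X] assms by simp
qed

lemma padic_cauchy_inverse:
  assumes "prime p" "padic_cauchy p X" "\<not> padic_null p X"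
  shows "padic_cauchy p (\<lambda>n. inverse (X n))"
  unfolding padic_cauchy_def
proof (intro allI impI)
  fix e :: real assume e: "e > 0"
  obtain c K where c: "c > 0" "\<And>n. n \<ge> K \<Longrightarrow> rat_padic_abs p (X n) = c"
    using padic_cauchy_nonnull[OF assms] by metis
  have "e * c * c > 0" using e c by simp
  then obtain M where M: "\<forall>m\<ge>M. \<forall>n\<ge>M. rat_padic_abs p (X m - X n) < e * c * c"
    using assms(2) unfolding padic_cauchy_def by metis
  have "rat_padic_abs p (inverse (X m) - inverse (X n)) < e" if "m \<ge> max M K" "n \<ge> max M K" for m n
  proof -
    have nz: "X m \<noteq> 0" "X n \<noteq> 0" using c(2)[of m] c(2)[of n] c(1) that by auto
    have "inverse (X m) - inverse (X n) = (X n - X m) * inverse (X m) * inverse (X n)"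
      using nz by (simp add: field_simps)
    then have "rat_padic_abs p (inverse (X m) - inverse (X n)) = rat_padic_abs p (X n - X m) / (c * c)"
      using c that by (simp add: rat_padic_abs_mult rat_padic_abs_inverse assms divide_inverse)
    also have "\<dots> < e" using M that c by (simp add: pos_divide_less_eq mult.assoc)
    finally show ?thesis .
  qed
  then show "\<exists>M. \<forall>m\<ge>M. \<forall>n\<ge>M. rat_padic_abs p (inverse (X m) - inverse (X n)) < e" by blast
qed


text \<open>
  The prime \<open>p\<close> is carried by the type parameter, as the cardinality of a type of prime cardinality.
  The field of \<open>p\<close>-adic numbers is the ring of \<open>p\<close>-adic Cauchy sequences of rationals modulo the
  ideal of null sequences.
\<close>

typedef (overloaded) 'p padic_seq = "{X. padic_cauchy CARD('p::prime_card) X}"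
  by (rule exI[of _ "\<lambda>_. 0"]) simp

setup_lifting type_definition_padic_seq

instantiation padic_seq :: (prime_card) comm_ring_1
begin

lift_definition zero_padic_seq :: "'a padic_seq" is "\<lambda>_. 0" by simp
lift_definition one_padic_seq :: "'a padic_seq" is "\<lambda>_. 1" by simp
lift_definition plus_padic_seq :: "'a padic_seq \<Rightarrow> 'a padic_seq \<Rightarrow> 'a padic_seq"
  is "\<lambda>X Y n. X n + Y n" by (rule padic_cauchy_add[OF prime_card])
lift_definition uminus_padic_seq :: "'a padic_seq \<Rightarrow> 'a padic_seq"
  is "\<lambda>X n. - X n" by (rule padic_cauchy_minus[OF prime_card])
lift_definition minus_padic_seq :: "'a padic_seq \<Rightarrow> 'a padic_seq \<Rightarrow> 'a padic_seq"
  is "\<lambda>X Y n. X n - Y n"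
  using padic_cauchy_add[OF prime_card] padic_cauchy_minus[OF prime_card]
  by (metis (no_types, lifting) add_uminus_conv_diff ext)
lift_definition times_padic_seq :: "'a padic_seq \<Rightarrow> 'a padic_seq \<Rightarrow> 'a padic_seq"
  is "\<lambda>X Y n. X n * Y n" by (rule padic_cauchy_mult[OF prime_card])

instance
  by standard (transfer; auto simp: algebra_simps fun_eq_iff)+

end

lift_definition padic_seq_null :: "'p::prime_card padic_seq \<Rightarrow> bool" is "padic_null CARD('p)" .

lift_definition padic_seq_inverse :: "'p::prime_card padic_seq \<Rightarrow> 'p padic_seq"
  is "\<lambda>X. if padic_null CARD('p) X then (\<lambda>_. 0) else (\<lambda>n. inverse (X n))"
  by (auto intro: padic_cauchy_inverse[OF prime_card])

lift_definition padic_seq_abs :: "'p::prime_card padic_seq \<Rightarrow> nat \<Rightarrow> real"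
  is "\<lambda>X n. rat_padic_abs CARD('p) (X n)" .

lemma padic_seq_null_iff: "padic_seq_null X \<longleftrightarrow> padic_seq_abs X \<longlonglongrightarrow> 0"
  by transfer (simp add: padic_null_def)

lemma padic_seq_null_0 [simp]: "padic_seq_null 0"
  by transfer (simp add: padic_null_def)

lemma padic_seq_null_add: "padic_seq_null X \<Longrightarrow> padic_seq_null Y \<Longrightarrow> padic_seq_null (X + Y)"
  by transfer (rule padic_null_add[OF prime_card])

lemma padic_seq_null_minus: "padic_seq_null X \<Longrightarrow> padic_seq_null (- X)"
  by transfer (rule padic_null_minus[OF prime_card])

lemma padic_seq_null_mult: "padic_seq_null X \<Longrightarrow> padic_seq_null (X * Y)"
  by transfer (rule padic_null_mult[OF prime_card])

lemma padic_seq_null_cong: "padic_seq_null (X - Y) \<Longrightarrow> padic_seq_null X \<longleftrightarrow> padic_seq_null Y"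
  by transfer (rule padic_null_cong[OF prime_card])

lemma padic_seq_nonnull_abs:
  assumes "\<not> padic_seq_null X"
  obtains c where "c > 0" "eventually (\<lambda>n. padic_seq_abs X n = c) sequentially"
proof -
  have "\<exists>c>0. eventually (\<lambda>n. padic_seq_abs X n = c) sequentially"
    using assms unfolding eventually_sequentially
    by transfer (metis padic_cauchy_nonnull prime_card)
  then show ?thesis using that by blast
qed

lemma padic_seq_inverse_right: "\<not> padic_seq_null X \<Longrightarrow> padic_seq_null (X * padic_seq_inverse X - 1)"
proof -
  assume *: "\<not> padic_seq_null X"
  obtain c where "c > 0" "eventually (\<lambda>n. padic_seq_abs X n = c) sequentially"
    using padic_seq_nonnull_abs[OF *] by metis
  then have "eventually (\<lambda>n. padic_seq_abs X n \<noteq> 0) sequentially"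
    by (auto elim: eventually_mono)
  then have "eventually (\<lambda>n. padic_seq_abs (X * padic_seq_inverse X - 1) n = 0) sequentially"
    using * by transfer (auto elim!: eventually_mono simp: rat_padic_abs_eq_0_iff[OF prime_card])
  then show ?thesis unfolding padic_seq_null_iff by (rule tendsto_eventually)
qed

lemma padic_seq_null_inverse: "padic_seq_null X \<Longrightarrow> padic_seq_inverse X = 0"
  by transfer simp

quotient_type 'p padic = "'p::prime_card padic_seq" / "\<lambda>X Y. padic_seq_null (X - Y)"
proof (rule equivpI)
  show "reflp (\<lambda>X Y :: 'p padic_seq. padic_seq_null (X - Y))"
    by (rule reflpI) simp
  show "symp (\<lambda>X Y :: 'p padic_seq. padic_seq_null (X - Y))"
    by (rule sympI) (metis minus_diff_eq padic_seq_null_minus)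
  show "transp (\<lambda>X Y :: 'p padic_seq. padic_seq_null (X - Y))"
    by (rule transpI) (metis diff_add_cancel add_diff_eq padic_seq_null_add)
qed

instantiation padic :: (prime_card) field
begin

lift_definition zero_padic :: "'a padic" is 0 .
lift_definition one_padic :: "'a padic" is 1 .
lift_definition plus_padic :: "'a padic \<Rightarrow> 'a padic \<Rightarrow> 'a padic" is "(+)"
  by (metis add_diff_add padic_seq_null_add)
lift_definition uminus_padic :: "'a padic \<Rightarrow> 'a padic" is uminus
  by (metis minus_diff_minus padic_seq_null_minus)
lift_definition minus_padic :: "'a padic \<Rightarrow> 'a padic \<Rightarrow> 'a padic" is "(-)"
proof -
  fix X Y Z W :: "'a padic_seq"
  assume "padic_seq_null (X - Y)" "padic_seq_null (Z - W)"
  then have "padic_seq_null ((X - Y) + - (Z - W))" by (intro padic_seq_null_add padic_seq_null_minus)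
  then show "padic_seq_null (X - Z - (Y - W))" by (simp add: algebra_simps)
qed
lift_definition times_padic :: "'a padic \<Rightarrow> 'a padic \<Rightarrow> 'a padic" is "(*)"
proof -
  fix X Y Z W :: "'a padic_seq"
  assume "padic_seq_null (X - Y)" "padic_seq_null (Z - W)"
  then have "padic_seq_null ((X - Y) * Z + (Z - W) * Y)" by (intro padic_seq_null_add padic_seq_null_mult)
  then show "padic_seq_null (X * Z - Y * W)" by (simp add: algebra_simps)
qed
lift_definition inverse_padic :: "'a padic \<Rightarrow> 'a padic" is padic_seq_inverse
proof -
  fix X Y :: "'a padic_seq"
  assume XY: "padic_seq_null (X - Y)"
  show "padic_seq_null (padic_seq_inverse X - padic_seq_inverse Y)"
  proof (cases "padic_seq_null X")
    case True
    then show ?thesis using padic_seq_null_cong[OF XY] by (simp add: padic_seq_null_inverse)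
  next
    case False
    let ?X = "padic_seq_inverse X" and ?Y = "padic_seq_inverse Y"
    have "padic_seq_null (X * ?X - 1)" "padic_seq_null (Y * ?Y - 1)"
      using False padic_seq_null_cong[OF XY] by (auto intro: padic_seq_inverse_right)
    then have "padic_seq_null ((X * ?X - 1) * ?Y + - ((Y * ?Y - 1) * ?X) + - ((X - Y) * (?X * ?Y)))"
      using XY by (intro padic_seq_null_add padic_seq_null_minus padic_seq_null_mult)
    then have "padic_seq_null (- (?Y - ?X))" by (simp add: algebra_simps)
    then show ?thesis by simp
  qed
qed
definition divide_padic :: "'a padic \<Rightarrow> 'a padic \<Rightarrow> 'a padic" where
  "divide_padic x y = x * inverse y"

instance
proof
  fix a b c :: "'a padic"
  show "a * b * c = a * (b * c)" by transfer (simp add: algebra_simps)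
  show "a * b = b * a" by transfer (simp add: algebra_simps)
  show "1 * a = a" by transfer simp
  show "a + b + c = a + (b + c)" by transfer (simp add: algebra_simps)
  show "a + b = b + a" by transfer (simp add: algebra_simps)
  show "0 + a = a" by transfer simp
  show "- a + a = 0" by transfer simp
  show "a - b = a + - b" by transfer simp
  show "(a + b) * c = a * c + b * c" by transfer (simp add: algebra_simps)
  show "(0::'a padic) \<noteq> 1"
    by (transfer, transfer) (simp add: padic_null_def rat_padic_abs_minus[OF prime_card] LIMSEQ_const_iff)
  show "a \<noteq> 0 \<Longrightarrow> inverse a * a = 1"
    by transfer (metis diff_zero mult.commute padic_seq_inverse_right)
  show "a div b = a * inverse b" by (rule divide_padic_def)
  show "inverse (0::'a padic) = 0" by transfer (simp add: padic_seq_null_inverse)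
qed

end

text \<open>The sequence of absolute values of a Cauchy sequence converges, so that \<open>lim\<close> is meaningful here.\<close>

lemma padic_seq_abs_convergent: "convergent (padic_seq_abs X)"
proof (cases "padic_seq_null X")
  case True
  then show ?thesis unfolding padic_seq_null_iff convergent_def by blast
next
  case False
  then obtain c where "eventually (\<lambda>n. padic_seq_abs X n = c) sequentially"
    using padic_seq_nonnull_abs by metis
  then show ?thesis unfolding convergent_def using tendsto_eventually by blast
qed

lemma padic_seq_abs_diff:
  "\<bar>padic_seq_abs X n - padic_seq_abs Y n\<bar> \<le> padic_seq_abs (X - Y) n"
  by transfer (rule rat_padic_abs_diff_abs[OF prime_card])

lift_definition padic_abs :: "'p::prime_card padic \<Rightarrow> real" is "\<lambda>X. lim (padic_seq_abs X)"
proof -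
  fix X Y :: "'p padic_seq"
  assume "padic_seq_null (X - Y)"
  then have "(\<lambda>n. padic_seq_abs X n - padic_seq_abs Y n) \<longlonglongrightarrow> 0"
    unfolding padic_seq_null_iff
    by (rule tendsto_0_le[where K = 1])
       (simp add: order_trans[OF padic_seq_abs_diff abs_ge_self])
  moreover have "(\<lambda>n. padic_seq_abs X n - padic_seq_abs Y n) \<longlonglongrightarrow> lim (padic_seq_abs X) - lim (padic_seq_abs Y)"
    using padic_seq_abs_convergent by (intro tendsto_diff) (auto simp: convergent_LIMSEQ_iff)
  ultimately show "lim (padic_seq_abs X) = lim (padic_seq_abs Y)"
    using LIMSEQ_unique by fastforce
qed

lemma padic_seq_abs_lim: "padic_seq_abs X \<longlonglongrightarrow> lim (padic_seq_abs X)"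
  using padic_seq_abs_convergent by (simp add: convergent_LIMSEQ_iff)

lemma padic_abs_nonneg [simp]: "padic_abs x \<ge> 0"
  by transfer (rule LIMSEQ_le_const[OF padic_seq_abs_lim], transfer, simp)

lemma padic_abs_eq_0_iff [simp]: "padic_abs x = 0 \<longleftrightarrow> x = 0"
  by transfer (metis LIMSEQ_unique diff_zero padic_seq_abs_lim padic_seq_null_iff)

lemma padic_abs_0: "padic_abs 0 = 0"
  by simp

lemma padic_abs_1 [simp]: "padic_abs 1 = 1"
proof -
  have "padic_seq_abs (1 :: 'a padic_seq) = (\<lambda>_. 1)" by transfer simp
  then show ?thesis by transfer simp
qed

lemma padic_abs_mult: "padic_abs (x * y) = padic_abs x * padic_abs y"
proof transfer
  fix X Y :: "'a padic_seq"
  have "padic_seq_abs (X * Y) = (\<lambda>n. padic_seq_abs X n * padic_seq_abs Y n)"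
    by transfer (simp add: rat_padic_abs_mult[OF prime_card])
  then have "padic_seq_abs (X * Y) \<longlonglongrightarrow> lim (padic_seq_abs X) * lim (padic_seq_abs Y)"
    by (simp add: tendsto_mult padic_seq_abs_lim)
  then show "lim (padic_seq_abs (X * Y)) = lim (padic_seq_abs X) * lim (padic_seq_abs Y)"
    by (rule limI)
qed

lemma padic_abs_minus [simp]: "padic_abs (- x) = padic_abs x"
proof transfer
  fix X :: "'a padic_seq"
  have "padic_seq_abs (- X) = padic_seq_abs X"
    by transfer (simp add: rat_padic_abs_minus[OF prime_card])
  then show "lim (padic_seq_abs (- X)) = lim (padic_seq_abs X)" by simp
qed

lemma padic_abs_add: "padic_abs (x + y) \<le> max (padic_abs x) (padic_abs y)"
proof transfer
  fix X Y :: "'a padic_seq"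
  have "padic_seq_abs (X + Y) n \<le> max (padic_seq_abs X n) (padic_seq_abs Y n)" for n
    by transfer (rule rat_padic_abs_add[OF prime_card])
  then show "lim (padic_seq_abs (X + Y)) \<le> max (lim (padic_seq_abs X)) (lim (padic_seq_abs Y))"
    by (intro LIMSEQ_le[OF padic_seq_abs_lim tendsto_max[OF padic_seq_abs_lim padic_seq_abs_lim]]) auto
qed

lemma padic_abs_diff_commute: "padic_abs (x - y) = padic_abs (y - x)"
  by (metis minus_diff_eq padic_abs_minus)

instantiation padic :: (prime_card) metric_space
begin

definition dist_padic :: "'a padic \<Rightarrow> 'a padic \<Rightarrow> real" where
  "dist_padic x y = padic_abs (x - y)"

definition uniformity_padic :: "('a padic \<times> 'a padic) filter" where
  "uniformity_padic = (INF e\<in>{0<..}. principal {(x, y). dist x y < e})"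

definition open_padic :: "'a padic set \<Rightarrow> bool" where
  "open_padic U \<longleftrightarrow> (\<forall>x\<in>U. eventually (\<lambda>(x', y). x' = x \<longrightarrow> y \<in> U) uniformity)"

instance
proof
  fix x y z :: "'a padic"
  show "dist x y = 0 \<longleftrightarrow> x = y" by (simp add: dist_padic_def)
  have "padic_abs (x - y) \<le> max (padic_abs (x - z)) (padic_abs (z - y))"
    using padic_abs_add[of "x - z" "z - y"] by simp
  also have "\<dots> \<le> padic_abs (x - z) + padic_abs (z - y)" by simp
  finally show "dist x y \<le> dist x z + dist y z"
    by (simp add: dist_padic_def padic_abs_diff_commute[of y z])
qed (simp_all add: uniformity_padic_def open_padic_def)

end

lift_definition padic_const :: "rat \<Rightarrow> 'p::prime_card padic_seq" is "\<lambda>r _. r" by simp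

lemma of_nat_padic: "of_nat n = abs_padic (padic_const (of_nat n))"
proof (induction n)
  case 0
  have "padic_const 0 = (0::'a padic_seq)" by transfer simp
  then show ?case by (simp add: zero_padic_def)
next
  case (Suc n)
  have "padic_const (1 + rat_of_nat n) = (1 + padic_const (of_nat n) :: 'a padic_seq)"
    by transfer simp
  then show ?case using Suc by (simp add: one_padic_def plus_padic.abs_eq)
qed

lemma padic_abs_const:
  "padic_abs (abs_padic (padic_const r :: 'p::prime_card padic_seq)) = rat_padic_abs CARD('p) r"
proof -
  have "padic_seq_abs (padic_const r :: 'p padic_seq) = (\<lambda>_. rat_padic_abs CARD('p) r)"
    by transfer simp
  then show ?thesis by (simp add: padic_abs.abs_eq)
qed

lemma padic_abs_of_nat: "padic_abs (of_nat n :: 'p::prime_card padic) = rat_padic_abs CARD('p) (of_nat n)"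
  by (simp add: of_nat_padic padic_abs_const)

instance padic :: (prime_card) field_char_0
proof
  show "inj (of_nat :: nat \<Rightarrow> 'a padic)"
  proof (rule injI)
    have *: "m = n" if "of_nat m = (of_nat n :: 'a padic)" "m \<le> n" for m n
    proof -
      have "of_nat (n - m) = (0 :: 'a padic)" using that by (simp add: of_nat_diff)
      then have "rat_padic_abs CARD('a) (of_nat (n - m)) = 0"
        using padic_abs_of_nat[of "n - m", where 'p = 'a] by (metis padic_abs_0)
      then have "rat_of_nat (n - m) = 0" by (simp only: rat_padic_abs_eq_0_iff[OF prime_card])
      then show ?thesis using that by (metis diff_is_0_eq le_antisym of_nat_eq_0_iff)
    qed
    show "m = n" if "of_nat m = (of_nat n :: 'a padic)" for m n
      using *[of m n] *[of n m] that by (cases "m \<le> n") auto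
  qed
qed

text \<open>
  The rationals embed isometrically and densely, and the resulting metric space is complete.
\<close>

lemma padic_const_diff: "padic_const (r - s) = padic_const r - padic_const s"
  by transfer simp

lemma padic_const_mult: "padic_const (r * s) = padic_const r * padic_const s"
  by transfer simp

lemma of_int_padic: "of_int k = abs_padic (padic_const (of_int k))"
proof -
  obtain m n where k: "k = int m - int n" by (metis int_diff_cases)
  show ?thesis
    by (simp add: k of_nat_padic padic_const_diff minus_padic.abs_eq)
qed

lemma of_rat_padic: "of_rat r = abs_padic (padic_const r)"
proof -
  obtain a b where r: "r = Rat.Fract a b" "b > 0" by (cases r)
  have "r * of_int b = of_int a" using r by (simp add: Fract_of_int_quotient)
  then have "padic_const r * padic_const (of_int b) = (padic_const (of_int a) :: 'a padic_seq)"
    by (metis padic_const_mult)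
  then have "abs_padic (padic_const r) * of_int b = (of_int a :: 'a padic)"
    by (simp add: of_int_padic times_padic.abs_eq)
  moreover have "of_rat r * of_int b = (of_int a :: 'a padic)"
    using \<open>r * of_int b = of_int a\<close> by (metis of_rat_mult of_rat_of_int_eq)
  moreover have "of_int b \<noteq> (0 :: 'a padic)" using r by simp
  ultimately show ?thesis by (metis mult_right_cancel)
qed

lemma padic_abs_of_rat: "padic_abs (of_rat r :: 'p::prime_card padic) = rat_padic_abs CARD('p) r"
  by (simp add: of_rat_padic padic_abs_const)

lemma padic_rat_approx:
  fixes x :: "'p::prime_card padic"
  assumes "e > 0"
  shows "\<exists>r. padic_abs (x - of_rat r) < e"
proof -
  obtain X where x: "x = abs_padic X" using Quotient3_abs_rep[OF Quotient3_padic] by metis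
  have "\<exists>M. \<forall>n\<ge>M. \<forall>m\<ge>M. rat_padic_abs CARD('p) (Rep_padic_seq X n - Rep_padic_seq X m) < e / 2"
    using Rep_padic_seq[of X] half_gt_zero[OF assms] unfolding padic_cauchy_def mem_Collect_eq by blast
  then obtain M where M: "\<And>n. n \<ge> M \<Longrightarrow> rat_padic_abs CARD('p) (Rep_padic_seq X n - Rep_padic_seq X M) < e / 2"
    by blast
  let ?r = "Rep_padic_seq X M"
  have "padic_seq_abs (X - padic_const ?r) n < e / 2" if "n \<ge> M" for n
    using M[OF that] by (simp add: padic_seq_abs.rep_eq minus_padic_seq.rep_eq padic_const.rep_eq)
  then have "lim (padic_seq_abs (X - padic_const ?r)) \<le> e / 2"
    by (intro LIMSEQ_le_const2[OF padic_seq_abs_lim]) (meson less_imp_le)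
  then have "padic_abs (x - of_rat ?r) \<le> e / 2"
    by (simp add: x of_rat_padic minus_padic.abs_eq padic_abs.abs_eq)
  then show ?thesis using assms by (intro exI[of _ ?r]) simp
qed

instance padic :: (prime_card) complete_space
proof
  fix x :: "nat \<Rightarrow> 'a padic"
  assume x: "Cauchy x"
  define r where "r n = (SOME r. padic_abs (x n - of_rat r) < inverse (real (Suc n)))" for n
  have r: "padic_abs (x n - of_rat (r n)) < inverse (real (Suc n))" for n
    unfolding r_def by (rule someI_ex[OF padic_rat_approx]) simp
  have r_small: "\<exists>M. \<forall>n\<ge>M. padic_abs (x n - of_rat (r n)) < e" if "e > 0" for e
  proof -
    obtain M where M: "inverse (real (Suc M)) < e" using reals_Archimedean[OF \<open>e > 0\<close>] by auto
    have "padic_abs (x n - of_rat (r n)) < e" if "n \<ge> M" for n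
    proof -
      have "inverse (real (Suc n)) \<le> inverse (real (Suc M))" using that by (intro le_imp_inverse_le) auto
      then show ?thesis using r[of n] M by linarith
    qed
    then show ?thesis by blast
  qed
  have ultra: "padic_abs (u + v) < e" if "padic_abs u < e" "padic_abs v < e" for u v :: "'a padic" and e
    using padic_abs_add[of u v] that by simp
  have r_cauchy: "padic_cauchy CARD('a) r"
    unfolding padic_cauchy_def
  proof (intro allI impI)
    fix e :: real assume e: "e > 0"
    obtain M where M: "\<forall>n\<ge>M. padic_abs (x n - of_rat (r n)) < e" using r_small[OF e] by blast
    obtain N where N: "\<forall>m\<ge>N. \<forall>n\<ge>N. padic_abs (x m - x n) < e"
      using metric_CauchyD[OF x e] by (auto simp: dist_padic_def)
    have "rat_padic_abs CARD('a) (r m - r n) < e" if "m \<ge> max M N" "n \<ge> max M N" for m n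
    proof -
      have "padic_abs ((of_rat (r m) - x m) + ((x m - x n) + (x n - of_rat (r n)))) < e"
        using M N that by (intro ultra) (auto simp: padic_abs_diff_commute[of "of_rat _"])
      then have "padic_abs (of_rat (r m - r n) :: 'a padic) < e" by (simp add: of_rat_diff)
      then show ?thesis by (simp add: padic_abs_of_rat)
    qed
    then show "\<exists>M. \<forall>m\<ge>M. \<forall>n\<ge>M. rat_padic_abs CARD('a) (r m - r n) < e" by blast
  qed
  define l :: "'a padic" where "l = abs_padic (Abs_padic_seq r)"
  have rep: "Rep_padic_seq (Abs_padic_seq r :: 'a padic_seq) = r"
    using r_cauchy by (simp add: Abs_padic_seq_inverse)
  have "x \<longlonglongrightarrow> l"
    unfolding lim_sequentially
  proof (intro allI impI)
    fix e :: real assume e: "e > 0"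
    obtain M where M: "\<forall>n\<ge>M. padic_abs (x n - of_rat (r n)) < e" using r_small[OF e] by blast
    have "e / 2 > 0" using e by simp
    then obtain N where N: "\<forall>m\<ge>N. \<forall>n\<ge>N. rat_padic_abs CARD('a) (r m - r n) < e / 2"
      using r_cauchy unfolding padic_cauchy_def by blast
    have "padic_abs (of_rat (r n) - l) < e" if "n \<ge> N" for n
    proof -
      have "padic_seq_abs (padic_const (r n) - Abs_padic_seq r :: 'a padic_seq) m < e / 2" if "m \<ge> N" for m
        using N that \<open>n \<ge> N\<close>
        by (simp add: padic_seq_abs.rep_eq minus_padic_seq.rep_eq padic_const.rep_eq rep)
      then have "lim (padic_seq_abs (padic_const (r n) - Abs_padic_seq r :: 'a padic_seq)) \<le> e / 2"
        by (intro LIMSEQ_le_const2[OF padic_seq_abs_lim]) (meson less_imp_le)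
      then have "padic_abs (of_rat (r n) - l) \<le> e / 2"
        by (simp add: l_def of_rat_padic minus_padic.abs_eq padic_abs.abs_eq)
      then show ?thesis using e by simp
    qed
    then have "padic_abs ((x n - of_rat (r n)) + (of_rat (r n) - l)) < e" if "n \<ge> max M N" for n
      using M that by (intro ultra) auto
    then show "\<exists>no. \<forall>n\<ge>no. dist (x n) l < e"
      unfolding dist_padic_def by (intro exI[of _ "max M N"]) auto
  qed
  then show "convergent x" by (rule convergentI)
qed

lemma rat_padic_abs_prime: "prime p \<Longrightarrow> rat_padic_abs p (of_nat p) = inverse (real p)"
  using rat_padic_val_Fract[of p "int p" 1]
  by (simp add: rat_padic_abs_def Fract_of_int_quotient power_int_minus prime_gt_0_nat)

lemma padic_abs_prime: "padic_abs (of_nat CARD('p) :: 'p::prime_card padic) = inverse (real CARD('p))"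
  by (simp add: padic_abs_of_nat rat_padic_abs_prime[OF prime_card])

lemma padic_abs_power: "padic_abs (x ^ n) = padic_abs x ^ n"
  by (induction n) (simp_all add: padic_abs_mult)

text \<open>No point is isolated, so that limits along \<open>at x\<close> are unique.\<close>

instance padic :: (prime_card) perfect_space
proof
  fix x :: "'a padic"
  show "\<not> open {x}"
  proof
    assume "open {x}"
    then obtain e where e: "e > 0" "\<And>y. dist y x < e \<Longrightarrow> y = x"
      unfolding open_dist by auto
    have p: "real CARD('a) > 1" using prime_gt_1_nat[OF prime_card] by simp
    then obtain n where "inverse (real CARD('a)) ^ n < e"
      using real_arch_pow_inv[OF e(1), of "inverse (real CARD('a))"] by (auto simp: inverse_less_1_iff)
    then have "dist (x + of_nat CARD('a) ^ n) x < e"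
      by (simp add: dist_padic_def padic_abs_power padic_abs_prime)
    then have "(of_nat CARD('a) :: 'a padic) ^ n = 0" using e(2) by fastforce
    then show False using p by simp
  qed
qed


section \<open>Fixed points and their multipliers\<close>

definition has_padic_derivative ::
    "('p::prime_card padic \<Rightarrow> 'p padic) \<Rightarrow> 'p padic \<Rightarrow> 'p padic \<Rightarrow> bool" where
  "has_padic_derivative f l x \<longleftrightarrow> ((\<lambda>y. (f y - f x) / (y - x)) \<longlongrightarrow> l) (at x)"

lemma has_padic_derivative_unique:
  "has_padic_derivative f l x \<Longrightarrow> has_padic_derivative f m x \<Longrightarrow> l = m"
  unfolding has_padic_derivative_def by (rule tendsto_unique[OF at_neq_bot])

definition attractive_fixed_point :: "('p::prime_card padic \<Rightarrow> 'p padic) \<Rightarrow> 'p padic \<Rightarrow> bool" where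
  "attractive_fixed_point f x \<longleftrightarrow> f x = x \<and> (\<exists>l. has_padic_derivative f l x \<and> padic_abs l < 1)"

definition neutral_fixed_point :: "('p::prime_card padic \<Rightarrow> 'p padic) \<Rightarrow> 'p padic \<Rightarrow> bool" where
  "neutral_fixed_point f x \<longleftrightarrow> f x = x \<and> (\<exists>l. has_padic_derivative f l x \<and> padic_abs l = 1)"

end

theory Submission
  imports Defs
begin

text \<open>
  With \<open>D x = x + \<theta> + q - 1\<close> one has \<open>f' x = 2 (\<theta> x + q) (\<theta> - 1) (\<theta> + q) / (D x)^3\<close>. Put
  \<open>T = |\<theta>| > 1\<close>. In the ultrametric absolute value the dominant summand decides each factor, and
  \<open>|2| = 1\<close>, \<open>|\<theta> - 1| = |\<theta> + q| = T\<close>. At \<open>1\<close>, \<open>x\<^sub>1\<close>, \<open>x\<^sub>2\<close> the pair \<open>(|\<theta> x + q|, |D x|)\<close> is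
  \<open>(T, T)\<close>, \<open>(T^3, T^2)\<close>, \<open>(|q|, T)\<close>, so the multipliers have absolute values \<open>1\<close>, \<open>1 / T\<close>
  and \<open>|q| / T\<close>.
\<close>

lemma padic_abs_inverse: "padic_abs (inverse x) = inverse (padic_abs x)"
proof (cases "x = 0")
  case False
  then have "padic_abs x * padic_abs (inverse x) = 1"
    by (simp flip: padic_abs_mult)
  then show ?thesis by (metis inverse_unique)
qed (simp add: padic_abs_0)

lemma padic_abs_divide: "padic_abs (x / y) = padic_abs x / padic_abs y"
  by (simp add: divide_inverse padic_abs_mult padic_abs_inverse)

lemma padic_abs_power_int: "padic_abs (x powi n) = padic_abs x powi n"
  by (simp add: power_int_def padic_abs_power padic_abs_inverse)

text \<open>Apply the ultrametric inequality to \<open>y = (x + y) + (- x)\<close>: the maximum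
  cannot be attained by \<open>x\<close>, so \<open>y\<close> is bounded by \<open>x + y\<close>.
  This is the tool that reads off every absolute value from a dominant summand.\<close>

lemma padic_abs_add_eq_right:
  assumes "padic_abs x < padic_abs y"
  shows "padic_abs (x + y) = padic_abs y"
proof -
  have "padic_abs y \<le> max (padic_abs (x + y)) (padic_abs x)"
    using padic_abs_add[of "x + y" "- x"] by simp
  then show ?thesis using padic_abs_add[of x y] assms by simp
qed

lemma padic_abs_add_eq_left:
  "padic_abs y < padic_abs x \<Longrightarrow> padic_abs (x + y) = padic_abs x"
  using padic_abs_add_eq_right[of y x] by (simp add: add.commute)

lemma padic_abs_of_nat_le_1: "padic_abs (of_nat n) \<le> 1"
proof (induction n)
  case (Suc n)
  then show ?case using padic_abs_add[of 1 "of_nat n"] by (simp add: max_def split: if_splits)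
qed (simp add: padic_abs_0)

text \<open>Used for n = 2: it makes the factor 2 in the derivative invisible, and is where p >= 3
  enters.\<close>

lemma padic_abs_of_nat_eq_1:
  assumes "\<not> CARD('p) dvd n"
  shows "padic_abs (of_nat n :: 'p::prime_card padic) = 1"
proof -
  have n: "n \<noteq> 0" using assms by (metis dvd_0_right)
  have "\<not> int CARD('p) dvd int n" using assms by simp
  then have "multiplicity (int CARD('p)) (int n) = 0"
    by (rule not_dvd_imp_multiplicity_0)
  then have "rat_padic_val CARD('p) (of_nat n) = 0"
    using rat_padic_val_Fract[OF prime_card[where 'a = 'p], of "int n" 1] n
    by (simp add: Fract_of_int_quotient)
  then show ?thesis using n by (simp add: padic_abs_of_nat rat_padic_abs_def)
qed

text \<open>Turns p-adic limits into real ones, so that the limit laws below follow from real limits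
  and estimates of the error term.\<close>

lemma padic_tendsto_iff:
  "(g \<longlongrightarrow> l) F \<longleftrightarrow> ((\<lambda>y. padic_abs (g y - l)) \<longlongrightarrow> 0) F"
  by (subst tendsto_dist_iff) (simp add: dist_padic_def)

lemma padic_tendsto_add:
  assumes "(g \<longlongrightarrow> l) F" "(h \<longlongrightarrow> m) F"
  shows "((\<lambda>y. g y + h y) \<longlongrightarrow> (l + m :: 'p::prime_card padic)) F"
  unfolding padic_tendsto_iff
proof (rule tendsto_sandwich[OF _ _ tendsto_const])
  have "padic_abs (g y + h y - (l + m)) \<le> max (padic_abs (g y - l)) (padic_abs (h y - m))" for y
    using padic_abs_add[of "g y - l" "h y - m"] by (simp add: algebra_simps)
  then show "\<forall>\<^sub>F y in F. padic_abs (g y + h y - (l + m))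
      \<le> max (padic_abs (g y - l)) (padic_abs (h y - m))" by simp
  show "((\<lambda>y. max (padic_abs (g y - l)) (padic_abs (h y - m))) \<longlongrightarrow> 0) F"
    using tendsto_max[OF assms[unfolded padic_tendsto_iff]] by simp
qed simp

lemma padic_tendsto_mult:
  assumes "(g \<longlongrightarrow> l) F" "(h \<longlongrightarrow> m) F"
  shows "((\<lambda>y. g y * h y) \<longlongrightarrow> (l * m :: 'p::prime_card padic)) F"
  unfolding padic_tendsto_iff
proof (rule tendsto_sandwich[OF _ _ tendsto_const])
  let ?u = "\<lambda>y. padic_abs (g y - l)" and ?v = "\<lambda>y. padic_abs (h y - m)"
  \<comment> \<open>One entry for each summand of the expansion of \<open>g y * h y - l * m\<close>
    in the errors \<open>g y - l\<close> and \<open>h y - m\<close>.\<close>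
  let ?B = "\<lambda>y. max (?u y * ?v y) (max (padic_abs l * ?v y) (?u y * padic_abs m))"
  have "padic_abs (g y * h y - l * m) \<le> ?B y" for y
  proof -
    have "g y * h y - l * m = (g y - l) * (h y - m) + (l * (h y - m) + (g y - l) * m)"
      by (simp add: algebra_simps)
    then show ?thesis
      using padic_abs_add[of "(g y - l) * (h y - m)" "l * (h y - m) + (g y - l) * m"]
        padic_abs_add[of "l * (h y - m)" "(g y - l) * m"]
      by (simp add: padic_abs_mult le_max_iff_disj) linarith
  qed
  then show "\<forall>\<^sub>F y in F. padic_abs (g y * h y - l * m) \<le> ?B y" by simp
  have "(?B \<longlongrightarrow> max (0 * 0) (max (padic_abs l * 0) (0 * padic_abs m))) F"
    using assms[unfolded padic_tendsto_iff] by (intro tendsto_intros)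
  then show "(?B \<longlongrightarrow> 0) F" by simp
qed simp

text \<open>As soon as \<open>g y\<close> is closer to \<open>l\<close> than |l|, its absolute value
  equals |l| exactly, so the error of the inverse is the error of \<open>g y\<close> divided by the
  constant |l|^2.\<close>

lemma padic_tendsto_inverse:
  assumes "(g \<longlongrightarrow> l) F" "l \<noteq> (0 :: 'p::prime_card padic)"
  shows "((\<lambda>y. inverse (g y)) \<longlongrightarrow> inverse l) F"
  unfolding padic_tendsto_iff
proof (rule Lim_transform_eventually)
  have "\<forall>\<^sub>F y in F. dist (g y) l < padic_abs l"
    using assms by (intro tendstoD) (simp_all add: less_le)
  then show "\<forall>\<^sub>F y in F. padic_abs (g y - l) / (padic_abs l)\<^sup>2 = padic_abs (inverse (g y) - inverse l)"
  proof (rule eventually_mono)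
    fix y assume "dist (g y) l < padic_abs l"
    then have gy: "padic_abs (g y) = padic_abs l"
      using padic_abs_add_eq_right[of "g y - l" l] by (simp add: dist_padic_def)
    then have "g y \<noteq> 0" using assms(2) padic_abs_eq_0_iff by metis
    then have "inverse (g y) - inverse l = (l - g y) / (g y * l)"
      using assms(2) by (simp add: field_simps)
    then show "padic_abs (g y - l) / (padic_abs l)\<^sup>2 = padic_abs (inverse (g y) - inverse l)"
      by (simp add: padic_abs_divide padic_abs_mult gy padic_abs_diff_commute power2_eq_square)
  qed
  show "((\<lambda>y. padic_abs (g y - l) / (padic_abs l)\<^sup>2) \<longlongrightarrow> 0) F"
    using tendsto_divide[OF assms(1)[unfolded padic_tendsto_iff] tendsto_const, of "(padic_abs l)\<^sup>2"]
      assms(2) by simp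
qed

lemmas padic_tendsto_intros =
  tendsto_const tendsto_ident_at padic_tendsto_add padic_tendsto_mult padic_tendsto_inverse

text \<open>The difference of two values of a Moebius map contains the factor \<open>y - x\<close>
  and the determinant \<open>a * d - b * c\<close>. A difference of squares inherits this factor,
  which cancels in the difference quotient.\<close>

lemma has_padic_derivative_moebius_square:
  fixes a b c d x :: "'p::prime_card padic"
  assumes D: "c * x + d \<noteq> 0"
  shows "has_padic_derivative (\<lambda>x. ((a * x + b) / (c * x + d))\<^sup>2)
    (2 * (a * x + b) * (a * d - b * c) / (c * x + d) ^ 3) x"
  unfolding has_padic_derivative_def
proof (rule Lim_transform_eventually)
  let ?h = "\<lambda>y. (a * y + b) * inverse (c * y + d)"
  \<comment> \<open>The difference quotient after cancelling \<open>y - x\<close>. It makes sense at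
    \<open>y = x\<close> too, and its value there is the derivative.\<close>
  let ?g = "\<lambda>y. (?h y + ?h x) * ((a * d - b * c) * (inverse (c * y + d) * inverse (c * x + d)))"
  have "(?g \<longlongrightarrow> ?g x) (at x)"
    using D by (intro padic_tendsto_intros)
  moreover have "?g x = 2 * (a * x + b) * (a * d - b * c) / (c * x + d) ^ 3"
    unfolding mult_2[symmetric] by (simp add: divide_inverse power3_eq_cube mult_ac)
  ultimately show "(?g \<longlongrightarrow> 2 * (a * x + b) * (a * d - b * c) / (c * x + d) ^ 3) (at x)"
    by simp
  have "((\<lambda>y. c * y + d) \<longlongrightarrow> c * x + d) (at x)"
    by (intro padic_tendsto_intros)
  then have "\<forall>\<^sub>F y in at x. c * y + d \<noteq> 0"
    using D by (rule tendsto_imp_eventually_ne)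
  moreover have "\<forall>\<^sub>F y in at x. y \<noteq> x"
    by (simp add: eventually_at_filter)
  ultimately show "\<forall>\<^sub>F y in at x.
      ?g y = (((a * y + b) / (c * y + d))\<^sup>2 - ((a * x + b) / (c * x + d))\<^sup>2) / (y - x)"
  proof eventually_elim
    case (elim y)
    have h: "?h y - ?h x = (y - x) * ((a * d - b * c) * (inverse (c * y + d) * inverse (c * x + d)))"
      using D elim by (simp add: divide_simps) (simp add: algebra_simps)
    have "(?h y)\<^sup>2 - (?h x)\<^sup>2 = (?h y + ?h x) * (?h y - ?h x)"
      by (simp only: power2_eq_square square_diff_square_factored)
    also have "\<dots> = (y - x) * ?g y"
      unfolding h by (simp only: mult_ac)
    finally show ?case using elim by (simp add: divide_inverse)
  qed
qed

theorem proposition5p6: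
  fixes N :: int and q :: nat
    and \<theta> x\<^sub>1 x\<^sub>2 :: "'p::prime_card padic"
    and f :: "'p padic \<Rightarrow> 'p padic"
  assumes "CARD('p) \<ge> 3"
    and "q \<ge> 1"
    and "N < 0"
    and "\<theta> = of_nat CARD('p) powi N"
    and "f = (\<lambda>x. ((\<theta> * x + of_nat q) / (x + \<theta> + of_nat q - 1))\<^sup>2)"
    and "{x. x\<^sup>2 + (2 * \<theta> - \<theta>\<^sup>2 + 2 * of_nat q - 1) * x + (of_nat q)\<^sup>2 = 0} = {x\<^sub>1, x\<^sub>2}"
    and "padic_abs x\<^sub>1 = (padic_abs \<theta>)\<^sup>2"
    and "padic_abs x\<^sub>2 = (padic_abs (of_nat q / \<theta>))\<^sup>2"
  shows "neutral_fixed_point f 1 \<and> attractive_fixed_point f x\<^sub>1 \<and> attractive_fixed_point f x\<^sub>2"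
proof -
  define Q :: "'p padic" where "Q = of_nat q"
  define D where "D x = x + (\<theta> + Q - 1)" for x
  let ?T = "padic_abs \<theta>"
  have p: "real CARD('p) > 1" using assms(1) by simp
  have "?T = inverse (real CARD('p)) powi N"
    by (simp add: assms(4) padic_abs_power_int padic_abs_prime)
  also have "\<dots> = real CARD('p) ^ nat (- N)"
    using assms(3) by (simp add: power_int_def)
  finally have T: "?T > 1" using p assms(3) by simp
  have Q1: "padic_abs Q \<le> 1" by (simp add: Q_def padic_abs_of_nat_le_1)
  \<comment> \<open>Positivity makes the comparison of \<open>\<theta> * x\<^sub>2\<close> with
    \<open>Q\<close> below strict.\<close>
  have Q0: "padic_abs Q > 0" using assms(2) by (simp add: Q_def less_le)
  have abs_T1: "padic_abs (\<theta> - 1) = ?T"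
    using padic_abs_add_eq_left[of "- 1" \<theta>] T by simp
  have abs_TQ: "padic_abs (\<theta> + Q) = ?T"
    using padic_abs_add_eq_left[of Q \<theta>] T Q1 by simp
  have abs_TQ1: "padic_abs (\<theta> + Q - 1) = ?T"
    using padic_abs_add_eq_left[of "- 1" "\<theta> + Q"] T abs_TQ by simp
  have "\<not> CARD('p) dvd 2" using assms(1) by (auto dest: dvd_imp_le)
  then have abs_2: "padic_abs (2 :: 'p padic) = 1"
    using padic_abs_of_nat_eq_1[of 2, where 'p = 'p] by simp

  \<comment> \<open>The factor \<open>1 *\<close> exhibits \<open>f\<close> as the square of a
    Moebius map with c = 1.\<close>
  have f_eq: "f = (\<lambda>x. ((\<theta> * x + Q) / (1 * x + (\<theta> + Q - 1)))\<^sup>2)"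
    by (simp add: assms(5) Q_def algebra_simps)
  have deriv: "has_padic_derivative f (2 * (\<theta> * x + Q) * ((\<theta> - 1) * (\<theta> + Q)) / D x ^ 3) x"
    if "D x \<noteq> 0" for x
  proof -
    \<comment> \<open>The determinant of the Moebius map factors, and both factors have absolute
      value \<open>?T\<close>.\<close>
    have "(\<theta> - 1) * (\<theta> + Q) = \<theta> * (\<theta> + Q - 1) - Q * 1" by (simp add: algebra_simps)
    then show ?thesis
      using has_padic_derivative_moebius_square[of 1 x "\<theta> + Q - 1" \<theta> Q] that
      unfolding f_eq D_def by simp
  qed
  have abs_deriv: "padic_abs (2 * (\<theta> * x + Q) * ((\<theta> - 1) * (\<theta> + Q)) / D x ^ 3)
      = padic_abs (\<theta> * x + Q) * ?T\<^sup>2 / padic_abs (D x) ^ 3" for x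
    unfolding padic_abs_divide padic_abs_mult padic_abs_power abs_2 abs_T1 abs_TQ
    by (simp add: power2_eq_square)
  \<comment> \<open>Since division by zero yields 0, \<open>f\<close> would take the value 0 where
    \<open>D x = 0\<close>; hence the second premise.\<close>
  have fixed: "f x = x"
    if "x\<^sup>2 + (2 * \<theta> - \<theta>\<^sup>2 + 2 * Q - 1) * x + Q\<^sup>2 = 0" "D x \<noteq> 0" for x
  proof -
    \<comment> \<open>Clearing denominators in \<open>f x = x\<close> gives a cubic; splitting off
      its root 1 leaves the given quadratic.\<close>
    have "x * (D x)\<^sup>2 - (\<theta> * x + Q)\<^sup>2 = (x - 1) * (x\<^sup>2 + (2 * \<theta> - \<theta>\<^sup>2 + 2 * Q - 1) * x + Q\<^sup>2)"
      unfolding D_def by (simp add: power2_eq_square algebra_simps)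
    then have "(\<theta> * x + Q)\<^sup>2 = x * (D x)\<^sup>2" using that(1) by simp
    then show ?thesis using that(2) by (simp add: f_eq D_def power_divide field_simps)
  qed
  have roots: "x\<^sup>2 + (2 * \<theta> - \<theta>\<^sup>2 + 2 * Q - 1) * x + Q\<^sup>2 = 0" if "x = x\<^sub>1 \<or> x = x\<^sub>2" for x
    using assms(6) that unfolding Q_def by blast

  have D1: "D 1 = \<theta> + Q" by (simp add: D_def)
  then have "D 1 \<noteq> 0" using abs_TQ T by (auto simp: padic_abs_0)
  moreover from this have "f 1 = 1" by (simp add: f_eq D_def)
  \<comment> \<open>Numerator and denominator of the Moebius map coincide at 1, so the quotient is T
    * T^2 / T^3.\<close>
  moreover have "padic_abs (\<theta> * 1 + Q) * ?T\<^sup>2 / padic_abs (D 1) ^ 3 = 1"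
    using T by (auto simp: D1 abs_TQ padic_abs_0 power2_eq_square power3_eq_cube)
  ultimately have "neutral_fixed_point f 1"
    unfolding neutral_fixed_point_def using deriv abs_deriv by metis

  moreover have "attractive_fixed_point f x\<^sub>1"
  proof -
    have "padic_abs (\<theta> * x\<^sub>1) = ?T ^ 3"
      by (simp add: padic_abs_mult assms(7) power2_eq_square power3_eq_cube)
    moreover have "1 < ?T ^ 3" using T by simp
    ultimately have num: "padic_abs (\<theta> * x\<^sub>1 + Q) = ?T ^ 3"
      using Q1 by (subst padic_abs_add_eq_left) auto
    have "?T < ?T\<^sup>2" using T by (simp add: power2_eq_square)
    then have D: "padic_abs (D x\<^sub>1) = ?T\<^sup>2"
      unfolding D_def by (subst padic_abs_add_eq_left) (simp_all add: assms(7) abs_TQ1)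
    then have "D x\<^sub>1 \<noteq> 0" using T by (auto simp: padic_abs_0)
    moreover from this have "f x\<^sub>1 = x\<^sub>1" by (intro fixed roots) simp
    \<comment> \<open>The quotient is T^3 * T^2 / T^6 = 1 / T.\<close>
    moreover have "padic_abs (\<theta> * x\<^sub>1 + Q) * ?T\<^sup>2 / padic_abs (D x\<^sub>1) ^ 3 < 1"
      using T unfolding num D by (simp add: field_simps power2_eq_square power3_eq_cube)
    ultimately show ?thesis
      unfolding attractive_fixed_point_def using deriv abs_deriv by metis
  qed

  moreover have "attractive_fixed_point f x\<^sub>2"
  proof -
    have x2: "padic_abs x\<^sub>2 = (padic_abs Q / ?T)\<^sup>2"
      by (simp add: assms(8) Q_def padic_abs_divide)
    have QT: "padic_abs Q / ?T < 1" "padic_abs Q / ?T > 0" using T Q0 Q1 by auto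
    \<comment> \<open>In contrast to \<open>x\<^sub>1\<close>, the terms containing
      \<open>x\<^sub>2\<close> are the small ones: \<open>Q\<close> dominates the numerator and
      \<open>\<theta> + Q - 1\<close> dominates \<open>D x\<^sub>2\<close>.\<close>
    have "padic_abs (\<theta> * x\<^sub>2) = padic_abs Q * (padic_abs Q / ?T)"
      using T by (simp add: padic_abs_mult x2 power2_eq_square)
    then have "padic_abs (\<theta> * x\<^sub>2) < padic_abs Q"
      using mult_strict_left_mono[OF QT(1) Q0] by simp
    then have num: "padic_abs (\<theta> * x\<^sub>2 + Q) = padic_abs Q"
      by (rule padic_abs_add_eq_right)
    have "(padic_abs Q / ?T)\<^sup>2 < 1" using QT by (simp add: power_less_one_iff)
    then have D: "padic_abs (D x\<^sub>2) = ?T"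
      using T unfolding D_def by (subst padic_abs_add_eq_right) (simp_all add: x2 abs_TQ1)
    then have "D x\<^sub>2 \<noteq> 0" using T by (auto simp: padic_abs_0)
    moreover from this have "f x\<^sub>2 = x\<^sub>2" by (intro fixed roots) simp
    \<comment> \<open>The quotient is |Q| * T^2 / T^3 = |Q| / T.\<close>
    moreover have "padic_abs (\<theta> * x\<^sub>2 + Q) * ?T\<^sup>2 / padic_abs (D x\<^sub>2) ^ 3 < 1"
      using T QT(1) unfolding num D by (simp add: field_simps power2_eq_square power3_eq_cube)
    ultimately show ?thesis
      unfolding attractive_fixed_point_def using deriv abs_deriv by metis
  qed
  ultimately show ?thesis by blast
qed

end
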